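(* Let $k\le n$, let $H:\mathbb{V}\to\mathbb{R}$ be a smooth Hamiltonian function and $f_H:\mathbb{V}\to Q^*$ a force field, where $\mathbb{V}=Q\oplus Q^*=\mathbb{R}^{2n}$, and let $X_H$, $X_F=(0,f_H)$, $X=X_H+X_F$ be the associated vector fields. Let $\sigma:\mathbb{W}\to\mathbb{V}$, $\mathbb{W}=\mathbb{R}^{2k}$, be the linear map with matrix $A\in\mathbb{R}^{2n\times 2k}$ satisfying $A^TJ_{2n}A=J_{2k}$ and $A_{qp}=0$, and let $\pi:\mathbb{V}\to\mathbb{W}$ be the linear map with matrix $A^+=J_{2k}^TA^TJ_{2n}$. Let $\tilde H=H\circ\sigma$ and $X_{\tilde F}(z)=\pi(X_F(\sigma(z)))$. Let $z\in\mathbb{W}$. Then the reduced forced Hamiltonian system exactly preserves the time derivative of system energy at $z$, i.e. $$d\tilde H\cdot X_{\tilde F}\big|_z=dH\cdot X_F\big|_{\sigma(z)},$$ if any one of the following conditions is satisfied at $\sigma(z)$: (a) $(\sigma\circ\pi)(X_F)=X_F$; (b) $(\sigma\circ\pi)(X_H)=X_H$; (c) $(\sigma\circ\pi)(X)=X$; (d) $(\pi_P\circ\sigma\circ\pi)(X_F)=\pi_P(X_F)$; (e) $(\pi_Q\circ\sigma\circ\pi)(X_H)=\pi_Q(X_H)$.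
   Context: $J_{2m}=\begin{bmatrix} 0_m & I_m \\ -I_m & 0_m \end{bmatrix}$. In canonical coordinates $Q=Q^*=\mathbb{R}^n$, $x=(q,p)\in\mathbb{V}$; $\pi_Q:(q,p)\mapsto q$ and $\pi_P:(q,p)\mapsto p$ are the canonical projections. The Hamiltonian vector field is $X_H(x)=J_{2n}\nabla_xH(x)=(\nabla_pH,-\nabla_qH)$. $A=\begin{bmatrix} A_{qq} & A_{qp} \\ A_{pq} & A_{pp} \end{bmatrix}$ with blocks in $\mathbb{R}^{n\times k}$. The reduced forced Hamiltonian system is $\dot z=X_{\tilde H}(z)+X_{\tilde F}(z)$ with $X_{\tilde H}(z)=J_{2k}\nabla_z\tilde H(z)$. The notation $dH\cdot Y|_x$ means the derivative of $H$ at $x$ applied to the vector $Y(x)$. *)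

theory Defs
  imports "HOL-Analysis.Analysis"
begin

text \<open>
  The phase space \<open>\<real>\<^sup>2\<^sup>m = \<real>\<^sup>m \<oplus> \<real>\<^sup>m\<close> is \<open>real^('m + 'm)\<close>: the indices \<open>Inl i\<close> carry the
  coordinates \<open>q\<close>, the indices \<open>Inr i\<close> the coordinates \<open>p\<close>.
\<close>

definition phase_point :: "real^'m \<Rightarrow> real^'m \<Rightarrow> real^('m::finite + 'm)" where
  "phase_point q p = (\<chi> i. case i of Inl a \<Rightarrow> q $ a | Inr a \<Rightarrow> p $ a)"

definition proj_Q :: "real^('m::finite + 'm) \<Rightarrow> real^'m" where
  "proj_Q x = (\<chi> a. x $ Inl a)"

definition proj_P :: "real^('m::finite + 'm) \<Rightarrow> real^'m" where
  "proj_P x = (\<chi> a. x $ Inr a)"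

text \<open>Block matrices; the arguments are the upper left, upper right, lower left and lower right
  block, where \<open>real^'c^'r\<close> is the type of matrices with rows \<open>'r\<close> and columns \<open>'c\<close>.\<close>

definition block_matrix ::
  "real^'k^'m \<Rightarrow> real^'k^'m \<Rightarrow> real^'k^'m \<Rightarrow> real^'k^'m
    \<Rightarrow> real^('k::finite + 'k)^('m::finite + 'm)" where
  "block_matrix B C D E =
    (\<chi> i j. case i of
        Inl a \<Rightarrow> (case j of Inl b \<Rightarrow> B $ a $ b | Inr b \<Rightarrow> C $ a $ b)
      | Inr a \<Rightarrow> (case j of Inl b \<Rightarrow> D $ a $ b | Inr b \<Rightarrow> E $ a $ b))"

definition symp_J :: "real^('m::finite + 'm)^('m + 'm)" where
  "symp_J = block_matrix 0 (mat 1) (- mat 1) 0"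

definition symplectic_inverse ::
  "real^('k::finite + 'k)^('m::finite + 'm) \<Rightarrow> real^('m + 'm)^('k + 'k)" where
  "symplectic_inverse A = transpose symp_J ** transpose A ** symp_J"

text \<open>Smoothness means \<open>C\<^sup>\<infinity>\<close> on the whole space: all iterated directional derivatives exist as
  Frechet differentiable, hence continuous, functions.\<close>

primrec times_cont_differentiable ::
  "nat \<Rightarrow> ('a::real_normed_vector \<Rightarrow> 'b::real_normed_vector) \<Rightarrow> bool" where
  "times_cont_differentiable 0 f \<longleftrightarrow> continuous_on UNIV f"
| "times_cont_differentiable (Suc r) f \<longleftrightarrow>
     (\<forall>x. f differentiable (at x)) \<and>
     (\<forall>v. times_cont_differentiable r (\<lambda>x. frechet_derivative f (at x) v))"

definition smooth :: "('a::real_normed_vector \<Rightarrow> 'b::real_normed_vector) \<Rightarrow> bool" where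
  "smooth f \<longleftrightarrow> (\<forall>r. times_cont_differentiable r f)"

definition gradient :: "(real^'i \<Rightarrow> real) \<Rightarrow> real^'i \<Rightarrow> real^'i::finite" where
  "gradient f x = (\<chi> i. frechet_derivative f (at x) (axis i 1))"

definition hamiltonian_field ::
  "(real^('m::finite + 'm) \<Rightarrow> real) \<Rightarrow> real^('m + 'm) \<Rightarrow> real^('m + 'm)" where
  "hamiltonian_field H x = symp_J *v gradient H x"

definition force_vector_field ::
  "(real^('m::finite + 'm) \<Rightarrow> real^'m) \<Rightarrow> real^('m + 'm) \<Rightarrow> real^('m + 'm)" where
  "force_vector_field f x = phase_point 0 (f x)"

lemma hamiltonian_field_canonical:
  "hamiltonian_field H x = phase_point (proj_P (gradient H x)) (- proj_Q (gradient H x))"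
proof -
  have *: "(\<Sum>j\<in>UNIV. g j) = (\<Sum>a\<in>UNIV. g (Inl a)) + (\<Sum>a\<in>UNIV. g (Inr a))"
    for g :: "'a + 'a \<Rightarrow> real"
    by (simp flip: UNIV_Plus_UNIV add: sum.Plus)
  show ?thesis
    by (auto simp: vec_eq_iff hamiltonian_field_def matrix_vector_mult_def symp_J_def
        block_matrix_def phase_point_def proj_P_def proj_Q_def mat_def * if_distrib
        if_distribR sum_negf cong: if_cong split: sum.split)
qed

end

theory Submission
  imports Defs
begin

text \<open>
  Write \<open>\<Omega>(x, y) = x \<bullet> J y\<close> and \<open>P = A A\<^sup>+\<close>. Since \<open>dH(v) = \<Omega>(X\<^sub>H, v)\<close>, the chain rule turns
  the claim into \<open>\<Omega>(X\<^sub>H, P X\<^sub>F) = \<Omega>(X\<^sub>H, X\<^sub>F)\<close>. The map \<open>P\<close> is self-adjoint for \<open>\<Omega>\<close>, hence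
  \<open>\<Omega>(v, P v) = 0\<close> for all \<open>v\<close>; this gives (b) and (c). As \<open>X\<^sub>F\<close> is vertical, \<open>\<Omega>(v, X\<^sub>F)\<close>
  depends only on the \<open>q\<close>-part of \<open>v\<close>, which gives (e). Finally \<open>A\<^sub>q\<^sub>p = 0\<close> makes \<open>P\<close> preserve
  vertical vectors, so (d) reduces to (a).
\<close>

lemma sum_UNIV_Plus:
  fixes g :: "'a::finite + 'b::finite \<Rightarrow> 'c::comm_monoid_add"
  shows "(\<Sum>j\<in>UNIV. g j) = (\<Sum>a\<in>UNIV. g (Inl a)) + (\<Sum>b\<in>UNIV. g (Inr b))"
  by (simp flip: UNIV_Plus_UNIV add: sum.Plus)

lemma block_matrix_mult_phase_point:
  "block_matrix B C D E *v phase_point q p = phase_point (B *v q + C *v p) (D *v q + E *v p)"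
  by (auto simp: vec_eq_iff matrix_vector_mult_def block_matrix_def phase_point_def sum_UNIV_Plus
      split: sum.split)

lemma transpose_block_matrix:
  "transpose (block_matrix B C D E)
    = block_matrix (transpose B) (transpose D) (transpose C) (transpose E)"
  by (auto simp: vec_eq_iff transpose_def block_matrix_def split: sum.split)

lemma phase_point_proj [simp]: "phase_point (proj_Q x) (proj_P x) = x"
  by (auto simp: vec_eq_iff phase_point_def proj_Q_def proj_P_def split: sum.split)

lemma proj_Q_phase_point [simp]: "proj_Q (phase_point q p) = q"
  by (simp add: vec_eq_iff phase_point_def proj_Q_def)

lemma inner_phase_point: "x \<bullet> phase_point q p = proj_Q x \<bullet> q + proj_P x \<bullet> p"
  by (simp add: inner_vec_def sum_UNIV_Plus phase_point_def proj_Q_def proj_P_def)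

lemma uminus_matrix_vector_mult: "(- A) *v x = - (A *v x)" for A :: "'a::ring_1^'n^'m"
  by (simp add: vec_eq_iff matrix_vector_mult_def sum_negf)

lemma symp_J_mult_phase_point: "symp_J *v phase_point q p = phase_point p (- q)"
  by (simp add: symp_J_def block_matrix_mult_phase_point uminus_matrix_vector_mult)

lemma phase_point_uminus: "phase_point (- q) (- p) = - phase_point q p"
  by (auto simp: vec_eq_iff phase_point_def split: sum.split)

lemma symp_J_symp_J_mult: "symp_J *v (symp_J *v x) = - x"
proof -
  have "symp_J *v (symp_J *v phase_point q p) = - phase_point q p" for q p :: "real^'a"
    by (simp add: symp_J_mult_phase_point phase_point_uminus)
  from this[of "proj_Q x" "proj_P x"] show ?thesis by simp
qed

lemma transpose_symp_J: "transpose symp_J = - symp_J"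
  by (auto simp: symp_J_def block_matrix_def transpose_def vec_eq_iff mat_def split: sum.split)

text \<open>On pairs (q, p) and (q', p') this is q \<bullet> p' - p \<bullet> q', the canonical
  symplectic form, with the sign for which contraction with a Hamiltonian vector field gives
  dH.\<close>

definition symp_form :: "real^('m::finite + 'm) \<Rightarrow> real^('m + 'm) \<Rightarrow> real" where
  "symp_form x y = x \<bullet> (symp_J *v y)"

lemma symp_form_add_left: "symp_form (x + y) w = symp_form x w + symp_form y w"
  by (simp add: symp_form_def inner_add_left)

lemma symp_form_skew: "symp_form y x = - symp_form x y"
proof -
  have "y \<bullet> (symp_J *v x) = (transpose symp_J *v y) \<bullet> x"
    by (simp add: transpose_matrix_vector dot_lmul_matrix)
  then show ?thesis
    by (simp add: symp_form_def transpose_symp_J uminus_matrix_vector_mult inner_commute)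
qed

lemma symp_form_self [simp]: "symp_form x x = 0"
  using symp_form_skew[of x x] by simp

lemma symp_form_vertical: "symp_form x (phase_point 0 p) = proj_Q x \<bullet> p"
  by (simp add: symp_form_def symp_J_mult_phase_point inner_phase_point)

text \<open>For symplectic \<open>A\<close> the symplectic inverse is a left inverse of
  \<open>A\<close>, so this is the projection onto the range of \<open>A\<close> along its
  symplectic complement.\<close>

definition symp_proj ::
  "real^('k::finite + 'k)^('m::finite + 'm) \<Rightarrow> real^('m + 'm) \<Rightarrow> real^('m + 'm)" where
  "symp_proj A x = A *v (symplectic_inverse A *v x)"

lemma symp_proj_altdef:
  "symp_proj A x = - (A *v (symp_J *v (transpose A *v (symp_J *v x))))"
  by (simp add: symp_proj_def symplectic_inverse_def transpose_symp_J uminus_matrix_vector_mult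
      linear_neg[OF matrix_vector_mul_linear] flip: matrix_vector_mul_assoc)

text \<open>Moving \<open>A\<close> across the inner product shows that \<Omega>(u, P v) is the
  pullback of the symplectic form along \<open>transpose A ** symp_J\<close>, hence skew in u and v.
  Combined with the skewness of \<Omega> itself, this lets P change sides.\<close>

lemma symp_form_symp_proj: "symp_form x (symp_proj A y) = symp_form (symp_proj A x) y"
proof -
  have *: "symp_form u (symp_proj A v)
      = symp_form (transpose A *v (symp_J *v u)) (transpose A *v (symp_J *v v))" for u v
  proof -
    have "symp_form u (symp_proj A v) = - symp_form (symp_proj A v) u"
      by (rule symp_form_skew)
    also have "\<dots> = (A *v (symp_J *v (transpose A *v (symp_J *v v)))) \<bullet> (symp_J *v u)"
      by (simp add: symp_form_def symp_proj_altdef)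
    also have "\<dots> = (symp_J *v (transpose A *v (symp_J *v v))) \<bullet> (transpose A *v (symp_J *v u))"
      by (simp add: transpose_matrix_vector dot_lmul_matrix inner_commute)
    finally show ?thesis
      by (simp add: symp_form_def inner_commute)
  qed
  show ?thesis
    using *[of x y] *[of y x] symp_form_skew[of y "symp_proj A x"]
      symp_form_skew[of "transpose A *v (symp_J *v y)" "transpose A *v (symp_J *v x)"]
    by simp
qed

lemma symp_form_symp_proj_self: "symp_form x (symp_proj A x) = 0"
  using symp_form_symp_proj[of x A x] symp_form_skew[of "symp_proj A x" x] by simp

text \<open>Follow (0, p) through the factors of P: \<open>symp_J\<close> gives (p, 0);
  \<open>transpose A\<close> is block upper triangular and keeps the second component 0;
  \<open>symp_J\<close> makes the vector vertical again, and the zero block of \<open>A\<close>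
  keeps it so.\<close>

lemma proj_Q_symp_proj_vertical:
  assumes "A = block_matrix B 0 D E"
  shows "proj_Q (symp_proj A (phase_point 0 p)) = 0"
proof -
  have "transpose (0 :: real^'a^'b) = 0"
    by (simp add: transpose_def vec_eq_iff)
  then show ?thesis
    by (simp add: assms symp_proj_altdef transpose_block_matrix block_matrix_mult_phase_point
        symp_J_mult_phase_point flip: phase_point_uminus)
qed

text \<open>Linearity along the standard basis turns the derivative into the pairing with the
  gradient; as \<open>symp_J\<close> squares to -1, this is -\<Omega>(v,
  \<open>hamiltonian_field H x\<close>).\<close>

lemma frechet_derivative_eq_symp_form:
  assumes "H differentiable (at x)"
  shows "frechet_derivative H (at x) v = symp_form (hamiltonian_field H x) v"
proof -
  have lin: "linear (frechet_derivative H (at x))"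
    using assms by (rule linear_frechet_derivative)
  have "frechet_derivative H (at x) v = frechet_derivative H (at x) (\<Sum>i\<in>UNIV. v $ i *s axis i 1)"
    by (simp add: basis_expansion)
  also have "\<dots> = gradient H x \<bullet> v"
    by (simp add: linear_sum[OF lin] linear_cmul[OF lin] scalar_mult_eq_scaleR gradient_def
        inner_vec_def mult.commute)
  also have "\<dots> = - symp_form v (hamiltonian_field H x)"
    by (simp add: symp_form_def hamiltonian_field_def symp_J_symp_J_mult inner_commute)
  finally show ?thesis
    by (simp add: symp_form_skew[of v])
qed

theorem theorem3p13:
  fixes H :: "real^('n::finite + 'n) \<Rightarrow> real"
    and f\<^sub>H :: "real^('n + 'n) \<Rightarrow> real^'n"
    and A :: "real^('k::finite + 'k)^('n + 'n)"
    and A\<^sub>q\<^sub>q A\<^sub>q\<^sub>p A\<^sub>p\<^sub>q A\<^sub>p\<^sub>p :: "real^'k^'n"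
    and \<sigma> :: "real^('k + 'k) \<Rightarrow> real^('n + 'n)"
    and \<pi> :: "real^('n + 'n) \<Rightarrow> real^('k + 'k)"
    and X\<^sub>H X\<^sub>F X :: "real^('n + 'n) \<Rightarrow> real^('n + 'n)"
    and H' :: "real^('k + 'k) \<Rightarrow> real"
    and X\<^sub>F' :: "real^('k + 'k) \<Rightarrow> real^('k + 'k)"
    and z :: "real^('k + 'k)"
  assumes "CARD('k) \<le> CARD('n)"
    and "smooth H"
    and "X\<^sub>H = hamiltonian_field H"
    and "X\<^sub>F = force_vector_field f\<^sub>H"
    and "X = (\<lambda>x. X\<^sub>H x + X\<^sub>F x)"
    and "A = block_matrix A\<^sub>q\<^sub>q A\<^sub>q\<^sub>p A\<^sub>p\<^sub>q A\<^sub>p\<^sub>p"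
    and "transpose A ** symp_J ** A = symp_J"
    and "A\<^sub>q\<^sub>p = 0"
    and "\<sigma> = (\<lambda>w. A *v w)"
    and "\<pi> = (\<lambda>x. symplectic_inverse A *v x)"
    and "H' = H \<circ> \<sigma>"
    and "X\<^sub>F' = (\<lambda>w. \<pi> (X\<^sub>F (\<sigma> w)))"
    and "(\<sigma> \<circ> \<pi>) (X\<^sub>F (\<sigma> z)) = X\<^sub>F (\<sigma> z)
       \<or> (\<sigma> \<circ> \<pi>) (X\<^sub>H (\<sigma> z)) = X\<^sub>H (\<sigma> z)
       \<or> (\<sigma> \<circ> \<pi>) (X (\<sigma> z)) = X (\<sigma> z)
       \<or> (proj_P \<circ> \<sigma> \<circ> \<pi>) (X\<^sub>F (\<sigma> z)) = proj_P (X\<^sub>F (\<sigma> z))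
       \<or> (proj_Q \<circ> \<sigma> \<circ> \<pi>) (X\<^sub>H (\<sigma> z)) = proj_Q (X\<^sub>H (\<sigma> z))"
  shows "frechet_derivative H' (at z) (X\<^sub>F' z)
       = frechet_derivative H (at (\<sigma> z)) (X\<^sub>F (\<sigma> z))"
proof -
  let ?v = "X\<^sub>F (\<sigma> z)" and ?h = "X\<^sub>H (\<sigma> z)" and ?P = "symp_proj A"
  have P: "\<sigma> (\<pi> x) = ?P x" for x
    by (simp add: assms(9,10) symp_proj_def)
  have v: "?v = phase_point 0 (f\<^sub>H (\<sigma> z))"
    by (simp add: assms(4) force_vector_field_def)
  \<comment> \<open>Order 1 of smoothness already contains differentiability at every point.\<close>
  have Hdiff: "H differentiable (at x)" for x
    using \<open>smooth H\<close> times_cont_differentiable.simps(2)[of 0 H] unfolding smooth_def by blast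
  have dH: "frechet_derivative H (at (\<sigma> z)) w = symp_form ?h w" for w
    using frechet_derivative_eq_symp_form[OF Hdiff] by (simp add: assms(3))
  have \<sigma>: "(\<sigma> has_derivative \<sigma>) (at z)"
    unfolding assms(9) by (rule bounded_linear_imp_has_derivative[OF matrix_vector_mul_bounded_linear])
  \<comment> \<open>Chain rule, the linear map \<sigma> being its own derivative.\<close>
  have "(H' has_derivative (frechet_derivative H (at (\<sigma> z)) \<circ> \<sigma>)) (at z)"
    unfolding \<open>H' = H \<circ> \<sigma>\<close>
    by (rule diff_chain_at[OF \<sigma>]) (simp add: Hdiff flip: frechet_derivative_works)
  then have "frechet_derivative H' (at z) = frechet_derivative H (at (\<sigma> z)) \<circ> \<sigma>"
    by (rule frechet_derivative_at[symmetric])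
  then have lhs: "frechet_derivative H' (at z) (X\<^sub>F' z) = symp_form ?h (?P ?v)"
    by (simp add: assms(12) P dH)
  have "symp_form ?h (?P ?v) = symp_form ?h ?v"
    using assms(13) unfolding o_apply P
  proof (elim disjE)
    assume "?P ?v = ?v"
    then show ?thesis by simp
  next
    assume "?P ?h = ?h"
    then show ?thesis by (simp add: symp_form_symp_proj)
  next
    assume "?P (X (\<sigma> z)) = X (\<sigma> z)"
    \<comment> \<open>Self-adjointness moves P onto the fixed vector \<open>?h + ?v\<close>.
      Expanding the sum, the terms \<Omega>(\<open>?v\<close>, P \<open>?v\<close>) and
      \<Omega>(\<open>?v\<close>, \<open>?v\<close>) vanish and only those with \<open>?h\<close>
      remain.\<close>
    then have "symp_form (?h + ?v) (?P ?v) = symp_form (?h + ?v) ?v"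
      by (simp add: symp_form_symp_proj assms(5))
    then show ?thesis
      by (simp add: symp_form_add_left symp_form_symp_proj_self)
  next
    assume "proj_P (?P ?v) = proj_P ?v"
    \<comment> \<open>Both sides are 0, since P keeps the vertical vector \<open>?v\<close>
      vertical.\<close>
    moreover have "proj_Q (?P ?v) = proj_Q ?v"
      using assms(6,8) by (simp add: v proj_Q_symp_proj_vertical)
    ultimately have "?P ?v = ?v"
      by (metis phase_point_proj)
    then show ?thesis by simp
  next
    assume "proj_Q (?P ?h) = proj_Q ?h"
    \<comment> \<open>With P moved onto \<open>?h\<close>, both sides pair a q-part with the force,
      and the q-parts agree.\<close>
    then show ?thesis
      by (simp add: symp_form_symp_proj v symp_form_vertical)
  qed
  then show ?thesis
    by (simp add: lhs dH)
qed

end
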